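(* (1) For every expression $e$, the map $\rho\mapsto \llbracket e\rrbracket_r(\rho)$ is a measurable function from $\Sigma_r$ to $\mathbb{R}_e$. (2) If $\mathcal{V}$ is finite or $\mathbf{proj}:\mathbb{R}_e\to\mathbb{F}_e$ is measurable, then for every expression $e$, the map $\rho\mapsto\llbracket e\rrbracket_f(\rho)$ is a measurable function from $\Sigma_f$ to $\mathbb{F}_e$.
   Context: $\mathcal{V}$ is a countable set of variables. Expressions are given by the grammar $e ::= a \mid x \mid \dot{-}e \mid e\,\dot{+}\,e \mid e\,\dot{-}\,e\mid e\,\dot{\times}\, e\mid e\,\dot{/}\,e$ with $a\in\mathbb{Q}$, $x\in\mathcal{V}$. Values. $\mathbb{F}\subset\mathbb{R}$ is the finite set of (finite) floating-point numbers, with smallest element $F_{\min}$ and largest element $F_{\max}$. Let $\mathbb{R}_e=\mathbb{R}\cup\{\mathbf{err}\}$, $\mathbb{F}_e=\mathbb{F}\cup\{\mathbf{err}\}$, where $\mathbf{err}$ is an extra symbol. Arithmetic is extended to $\mathbb{R}_e$ by: for $r\in\mathbb{R}_e$ and $\diamond\in\{+,-,\times,/\}$, $\mathbf{err}\diamond r=r\diamond\mathbf{err}=r/0=-\mathbf{err}=\mathbf{err}$. $\mathbf{inj}:\mathbb{F}_e\to\mathbb{R}_e$ is the canonical inclusion (with $\mathbf{inj}(\mathbf{err})=\mathbf{err}$). $\mathbf{proj}:\mathbb{R}_e\to\mathbb{F}_e$ is a fixed map with $\mathbf{proj}(r)=\mathbf{err}$ if $r\notin[F_{\min},F_{\max}]$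 (in particular if $r=\mathbf{err}$), and $\mathbf{proj}(\mathbf{inj}(f))=f$ for all $f\in\mathbb{F}_e$. Environments. $\Sigma_r$ is the set of maps $\mathcal{V}\to\mathbb{R}_e$, $\Sigma_f$ the set of maps $\mathcal{V}\to\mathbb{F}_e$. Real semantics: $\llbracket a\rrbracket_r(\rho)=a$, $\llbracket x\rrbracket_r(\rho)=\rho(x)$, $\llbracket \dot{-}e\rrbracket_r(\rho)=-\llbracket e\rrbracket_r(\rho)$, and $\llbracket e_1\dot{\diamond}e_2\rrbracket_r(\rho)=\llbracket e_1\rrbracket_r(\rho)\diamond\llbracket e_2\rrbracket_r(\rho)$ for $\diamond\in\{+,-,\times,/\}$. Floating-point semantics: $\llbracket a\rrbracket_f(\rho)=\mathbf{proj}(a)$, $\llbracket x\rrbracket_f(\rho)=\rho(x)$, $\llbracket \dot{-}e\rrbracket_f(\rho)=\mathbf{proj}(-\mathbf{inj}(\llbracket e\rrbracket_f(\rho)))$, and $\llbracket e_1\dot{\diamond}e_2\rrbracket_f(\rho)=\mathbf{proj}(\mathbf{inj}(\llbracket e_1\rrbracket_f(\rho))\diamond\mathbf{inj}(\llbracket e_2\rrbracket_f(\rho)))$. Topology and measurability. $\mathbb{R}_e$ has the topology whose opens are the open subsets of $\mathbb{R}$, the singleton $\{\mathbf{err}\}$, and their unions (so $\mathbf{err}$ is an isolated point). $\mathbb{F}_e$ has the discrete topology. $\Sigma_r\cong\mathbb{R}_e^{\mathcal{V}}$ and $\Sigma_f\cong\mathbb{F}_e^{\mathcal{V}}$ have the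 product topology. All spaces carry their Borel $\sigma$-algebras, and measurability is with respect to these. *)

theory Defs
  imports "HOL-Analysis.Analysis"
begin

datatype (vars: 'v) expr =
    Const rat
  | Var 'v
  | Neg "'v expr"
  | Add "'v expr" "'v expr"
  | Sub "'v expr" "'v expr"
  | Mul "'v expr" "'v expr"
  | Div "'v expr" "'v expr"

datatype real_err = Err | Val real

fun neg_err :: "real_err \<Rightarrow> real_err" where
  "neg_err (Val a) = Val (- a)"
| "neg_err Err = Err"

fun add_err :: "real_err \<Rightarrow> real_err \<Rightarrow> real_err" where
  "add_err (Val a) (Val b) = Val (a + b)"
| "add_err _ _ = Err"

fun sub_err :: "real_err \<Rightarrow> real_err \<Rightarrow> real_err" where
  "sub_err (Val a) (Val b) = Val (a - b)"
| "sub_err _ _ = Err"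

fun mul_err :: "real_err \<Rightarrow> real_err \<Rightarrow> real_err" where
  "mul_err (Val a) (Val b) = Val (a * b)"
| "mul_err _ _ = Err"

fun div_err :: "real_err \<Rightarrow> real_err \<Rightarrow> real_err" where
  "div_err (Val a) (Val b) = (if b = 0 then Err else Val (a / b))"
| "div_err _ _ = Err"

text \<open>
  The floating-point values with error form a subset of \<open>real_err\<close>, so the
  canonical inclusion of floating-point values into real values is the identity
  and is left implicit below.
\<close>

definition float_err :: "real set \<Rightarrow> real_err set" where
  "float_err F = insert Err (Val ` F)"

definition is_proj :: "real set \<Rightarrow> (real_err \<Rightarrow> real_err) \<Rightarrow> bool" where
  "is_proj F proj \<longleftrightarrow>
     (\<forall>r. proj r \<in> float_err F) \<and>
     (\<forall>r. r \<notin> Val ` {Min F..Max F} \<longrightarrow> proj r = Err) \<and>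
     (\<forall>f\<in>float_err F. proj f = f)"

primrec sem_real :: "'v expr \<Rightarrow> ('v \<Rightarrow> real_err) \<Rightarrow> real_err" where
  "sem_real (Const a) \<rho> = Val (of_rat a)"
| "sem_real (Var x) \<rho> = \<rho> x"
| "sem_real (Neg e) \<rho> = neg_err (sem_real e \<rho>)"
| "sem_real (Add e1 e2) \<rho> = add_err (sem_real e1 \<rho>) (sem_real e2 \<rho>)"
| "sem_real (Sub e1 e2) \<rho> = sub_err (sem_real e1 \<rho>) (sem_real e2 \<rho>)"
| "sem_real (Mul e1 e2) \<rho> = mul_err (sem_real e1 \<rho>) (sem_real e2 \<rho>)"
| "sem_real (Div e1 e2) \<rho> = div_err (sem_real e1 \<rho>) (sem_real e2 \<rho>)"

primrec sem_float ::
  "(real_err \<Rightarrow> real_err) \<Rightarrow> 'v expr \<Rightarrow> ('v \<Rightarrow> real_err) \<Rightarrow> real_err"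
where
  "sem_float proj (Const a) \<rho> = proj (Val (of_rat a))"
| "sem_float proj (Var x) \<rho> = \<rho> x"
| "sem_float proj (Neg e) \<rho> = proj (neg_err (sem_float proj e \<rho>))"
| "sem_float proj (Add e1 e2) \<rho> = proj (add_err (sem_float proj e1 \<rho>) (sem_float proj e2 \<rho>))"
| "sem_float proj (Sub e1 e2) \<rho> = proj (sub_err (sem_float proj e1 \<rho>) (sem_float proj e2 \<rho>))"
| "sem_float proj (Mul e1 e2) \<rho> = proj (mul_err (sem_float proj e1 \<rho>) (sem_float proj e2 \<rho>))"
| "sem_float proj (Div e1 e2) \<rho> = proj (div_err (sem_float proj e1 \<rho>) (sem_float proj e2 \<rho>))"

definition real_err_topology :: "real_err topology" where
  "real_err_topology =
     topology (\<lambda>U. \<exists>W. open W \<and> (U = Val ` W \<or> U = insert Err (Val ` W)))"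

lemma openin_real_err_topology:
  "openin real_err_topology U \<longleftrightarrow>
     (\<exists>W. open W \<and> (U = Val ` W \<or> U = insert Err (Val ` W)))"
proof -
  have eq: "(\<exists>W. open W \<and> (U = Val ` W \<or> U = insert Err (Val ` W))) \<longleftrightarrow> open (Val -` U)"
    for U
  proof
    assume "\<exists>W. open W \<and> (U = Val ` W \<or> U = insert Err (Val ` W))"
    then obtain W where W: "open W" "U = Val ` W \<or> U = insert Err (Val ` W)" by blast
    then have "Val -` U = W" by auto
    with W show "open (Val -` U)" by simp
  next
    assume op: "open (Val -` U)"
    have "U = Val ` (Val -` U) \<or> U = insert Err (Val ` (Val -` U))"
    proof -
      have "x \<in> U \<Longrightarrow> x \<noteq> Err \<Longrightarrow> x \<in> Val ` (Val -` U)" for x by (cases x) auto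
      then show ?thesis by blast
    qed
    with op show "\<exists>W. open W \<and> (U = Val ` W \<or> U = insert Err (Val ` W))" by blast
  qed
  have "istopology (\<lambda>U. open (Val -` U))"
    unfolding istopology_def by (auto simp: vimage_Union)
  then show ?thesis
    unfolding real_err_topology_def eq by (simp add: topology_inverse')
qed

definition borel_of :: "'a topology \<Rightarrow> 'a measure" where
  "borel_of X = sigma (topspace X) {U. openin X U}"

abbreviation real_err_space :: "real_err measure" where
  "real_err_space \<equiv> borel_of real_err_topology"

abbreviation float_err_space :: "real set \<Rightarrow> real_err measure" where
  "float_err_space F \<equiv> borel_of (discrete_topology (float_err F))"

text \<open>
  An environment over \<open>V\<close> is a function in \<open>V \<rightarrow>\<^sub>E A\<close>, that is, with the value
  \<open>undefined\<close> outside \<open>V\<close>; \<open>product_topology\<close> has this set as its carrier.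
\<close>

abbreviation real_env_space :: "'v set \<Rightarrow> ('v \<Rightarrow> real_err) measure" where
  "real_env_space V \<equiv> borel_of (product_topology (\<lambda>_. real_err_topology) V)"

abbreviation float_env_space :: "real set \<Rightarrow> 'v set \<Rightarrow> ('v \<Rightarrow> real_err) measure" where
  "float_env_space F V \<equiv>
     borel_of (product_topology (\<lambda>_. discrete_topology (float_err F)) V)"

end

theory Submission
  imports Defs
begin

text \<open>
  On the real side, each operation is the corresponding real operation, patched with
  \<open>Err\<close> on a measurable set. On the floating-point side, values lie in a finite discrete space,
  so composing measurable maps with any binary operation gives a measurable map.
\<close>

lemma space_borel_of [simp]: "space (borel_of X) = topspace X"
  unfolding borel_of_def by (rule space_measure_of) (auto dest: openin_subset)

lemma sets_borel_of: "sets (borel_of X) = sigma_sets (topspace X) {U. openin X U}"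
  unfolding borel_of_def by (intro sets_measure_of) (auto dest: openin_subset)

lemma openin_sets_borel_of: "openin X U \<Longrightarrow> U \<in> sets (borel_of X)"
  by (simp add: sets_borel_of sigma_sets.Basic)

text \<open>The open sets generate the Borel sigma-algebra, so their preimages decide
  measurability.\<close>

lemma measurable_borel_ofI:
  assumes "f \<in> space M \<rightarrow> topspace X"
    and "\<And>U. openin X U \<Longrightarrow> f -` U \<inter> space M \<in> sets M"
  shows "f \<in> measurable M (borel_of X)"
  unfolding borel_of_def using assms
  by (intro measurable_measure_of) (auto dest: openin_subset)

lemma continuous_map_measurable_borel_of:
  assumes "continuous_map X Y f"
  shows "f \<in> measurable (borel_of X) (borel_of Y)"
proof (rule measurable_borel_ofI)
  show "f \<in> space (borel_of X) \<rightarrow> topspace Y"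
    using assms by (simp add: continuous_map_funspace)
next
  fix U assume "openin Y U"
  then have "openin X {x \<in> topspace X. f x \<in> U}"
    by (rule openin_continuous_map_preimage[OF assms])
  moreover have "f -` U \<inter> space (borel_of X) = {x \<in> topspace X. f x \<in> U}"
    by auto
  ultimately show "f -` U \<inter> space (borel_of X) \<in> sets (borel_of X)"
    by (simp add: openin_sets_borel_of)
qed

text \<open>All subsets are open, and they already form a sigma-algebra. This gives access to the
  facts about \<open>count_space\<close>.\<close>

lemma sets_borel_of_discrete_topology:
  "sets (borel_of (discrete_topology A)) = sets (count_space A)"
proof -
  have "{U. openin (discrete_topology A) U} = Pow A" by auto
  then show ?thesis
    by (simp add: sets_borel_of sigma_algebra.sigma_sets_eq[OF sigma_algebra_Pow])
qed

lemma topspace_real_err_topology [simp]: "topspace real_err_topology = UNIV"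
proof -
  have "x \<in> insert Err (Val ` UNIV)" for x
    by (cases x) auto
  then have "openin real_err_topology UNIV"
    unfolding openin_real_err_topology by (intro exI[of _ UNIV]) auto
  then show ?thesis
    by (metis openin_subset top.extremum_uniqueI)
qed

text \<open>A total left inverse of \<open>Val\<close>. The value at \<open>Err\<close> is a
  default: the case formulas below test for \<open>Err\<close> first.\<close>

fun real_part :: "real_err \<Rightarrow> real" where
  "real_part (Val a) = a"
| "real_part Err = 0"

lemma measurable_Val [measurable]: "Val \<in> measurable borel real_err_space"
proof (rule measurable_borel_ofI)
  fix U assume "openin real_err_topology U"
  then obtain W where W: "open W" "U = Val ` W \<or> U = insert Err (Val ` W)"
    unfolding openin_real_err_topology by blast
  then have "Val -` U = W" by auto
  with W show "Val -` U \<inter> space borel \<in> sets borel" by simp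
qed simp

lemma measurable_real_part [measurable]: "real_part \<in> measurable real_err_space borel"
proof (rule borel_measurableI)
  fix W :: "real set" assume W: "open W"
  \<comment> \<open>The default 0 puts \<open>Err\<close> into the preimage exactly when 0 is in
    \<open>W\<close>; both shapes are open because \<open>Err\<close> is isolated.\<close>
  have "x \<in> real_part -` W \<longleftrightarrow>
      x \<in> (if 0 \<in> W then insert Err (Val ` W) else Val ` W)" for x
    by (cases x) auto
  then have "real_part -` W = (if 0 \<in> W then insert Err (Val ` W) else Val ` W)"
    by blast
  then have "openin real_err_topology (real_part -` W)"
    unfolding openin_real_err_topology using W by auto
  then show "real_part -` W \<inter> space real_err_space \<in> sets real_err_space"
    by (simp add: openin_sets_borel_of)
qed

text \<open>\<open>Err\<close> is an isolated point. This makes case distinctions on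
  \<open>Err\<close> measurable.\<close>

lemma pred_eq_Err [measurable]: "Measurable.pred real_err_space (\<lambda>x. x = Err)"
proof -
  have "openin real_err_topology {Err}"
    unfolding openin_real_err_topology by (intro exI[of _ "{}"]) auto
  then show ?thesis
    unfolding pred_def by (simp add: openin_sets_borel_of)
qed

lemma measurable_neg_err [measurable]: "neg_err \<in> measurable real_err_space real_err_space"
proof -
  have "neg_err x = (if x = Err then Err else Val (- real_part x))" for x
    by (cases x) auto
  then have eq: "neg_err = (\<lambda>x. if x = Err then Err else Val (- real_part x))"
    by blast
  show ?thesis unfolding eq by measurable
qed

text \<open>Common pattern of the four binary operations: \<open>P\<close> marks the second
  arguments that are sent to \<open>Err\<close> although they are real. Pairing takes place only
  after \<open>real_part\<close>, in the product of two copies of \<open>borel\<close>.\<close>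

lemma measurable_err_binop:
  fixes h :: "real \<Rightarrow> real \<Rightarrow> real"
  assumes h: "case_prod h \<in> measurable (borel \<Otimes>\<^sub>M borel) borel"
    and P: "Measurable.pred borel P"
    and op: "\<And>x y. op x y =
      (if x = Err \<or> y = Err \<or> P (real_part y) then Err else Val (h (real_part x) (real_part y)))"
    and [measurable]: "f \<in> measurable M real_err_space" "g \<in> measurable M real_err_space"
  shows "(\<lambda>x. op (f x) (g x)) \<in> measurable M real_err_space"
proof -
  note [measurable] = h P
  show ?thesis unfolding op by measurable
qed

text \<open>The recursion equations without the environment argument, since measurability speaks of
  the functions themselves.\<close>

lemma sem_real_eqs:
  "sem_real (Const a) = (\<lambda>_. Val (of_rat a))"
  "sem_real (Var x) = (\<lambda>\<rho>. \<rho> x)"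
  "sem_real (Neg e) = (\<lambda>\<rho>. neg_err (sem_real e \<rho>))"
  "sem_real (Add e1 e2) = (\<lambda>\<rho>. add_err (sem_real e1 \<rho>) (sem_real e2 \<rho>))"
  "sem_real (Sub e1 e2) = (\<lambda>\<rho>. sub_err (sem_real e1 \<rho>) (sem_real e2 \<rho>))"
  "sem_real (Mul e1 e2) = (\<lambda>\<rho>. mul_err (sem_real e1 \<rho>) (sem_real e2 \<rho>))"
  "sem_real (Div e1 e2) = (\<lambda>\<rho>. div_err (sem_real e1 \<rho>) (sem_real e2 \<rho>))"
  by (simp_all add: fun_eq_iff)

lemma measurable_sem_real:
  assumes "vars e \<subseteq> V"
  shows "sem_real e \<in> measurable (real_env_space V) real_err_space"
  using assms
proof (induction e)
  case (Const a)
  then show ?case by (simp add: sem_real_eqs)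
next
  case (Var x)
  \<comment> \<open>Evaluation at \<open>x\<close> is a projection of the product topology, hence
    continuous, as \<open>x\<close> lies in \<open>V\<close>.\<close>
  then show ?case
    unfolding sem_real_eqs
    by (intro continuous_map_measurable_borel_of)
      (auto intro: continuous_map_product_projection)
next
  case (Neg e)
  then have [measurable]: "sem_real e \<in> measurable (real_env_space V) real_err_space"
    by simp
  show ?case unfolding sem_real_eqs by measurable
next
  case (Add e1 e2)
  \<comment> \<open>The disjunct \<open>False\<close> gives the formula the shape that
    \<open>measurable_err_binop\<close> expects.\<close>
  have eq: "add_err x y = (if x = Err \<or> y = Err \<or> False then Err
      else Val (real_part x + real_part y))" for x y
    by (cases x; cases y) auto
  show ?case
    unfolding sem_real_eqs
    by (rule measurable_err_binop[where h = "(+)" and P = "\<lambda>_. False", OF _ _ eq])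
      (use Add in auto)
next
  case (Sub e1 e2)
  have eq: "sub_err x y = (if x = Err \<or> y = Err \<or> False then Err
      else Val (real_part x - real_part y))" for x y
    by (cases x; cases y) auto
  show ?case
    unfolding sem_real_eqs
    by (rule measurable_err_binop[where h = "(-)" and P = "\<lambda>_. False", OF _ _ eq])
      (use Sub in auto)
next
  case (Mul e1 e2)
  have eq: "mul_err x y = (if x = Err \<or> y = Err \<or> False then Err
      else Val (real_part x * real_part y))" for x y
    by (cases x; cases y) auto
  show ?case
    unfolding sem_real_eqs
    by (rule measurable_err_binop[where h = "(*)" and P = "\<lambda>_. False", OF _ _ eq])
      (use Mul in auto)
next
  case (Div e1 e2)
  \<comment> \<open>Here \<open>P\<close> singles out the zero divisor. Division on
    \<open>real\<close> is total and Borel measurable, so it can serve as \<open>h\<close>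
    everywhere.\<close>
  have eq: "div_err x y = (if x = Err \<or> y = Err \<or> real_part y = 0 then Err
      else Val (real_part x / real_part y))" for x y
    by (cases x; cases y) auto
  show ?case
    unfolding sem_real_eqs
    by (rule measurable_err_binop[where h = "(/)" and P = "\<lambda>y. y = 0", OF _ _ eq])
      (use Div in auto)
qed

text \<open>Split the space into the countably many measurable sets where \<open>f\<close> has a
  fixed value \<open>a\<close>. On each of them the map is \<open>g\<close> followed by
  \<open>h a\<close>, and every map out of a discrete space is measurable.\<close>

lemma measurable_countable_binop:
  assumes "countable A"
    and "f \<in> measurable M (count_space A)" "g \<in> measurable M (count_space A)"
    and "\<And>a b. h a b \<in> B"
  shows "(\<lambda>x. h (f x) (g x)) \<in> measurable M (count_space B)"
proof (rule measurable_compose_countable'[OF _ assms(2,1)])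
  fix a assume "a \<in> A"
  show "(\<lambda>x. h a (g x)) \<in> measurable M (count_space B)"
    by (rule measurable_compose[OF assms(3)]) (use assms(4) in auto)
qed

lemma sem_float_eqs:
  "sem_float proj (Const a) = (\<lambda>_. proj (Val (of_rat a)))"
  "sem_float proj (Var x) = (\<lambda>\<rho>. \<rho> x)"
  "sem_float proj (Neg e) = (\<lambda>\<rho>. proj (neg_err (sem_float proj e \<rho>)))"
  "sem_float proj (Add e1 e2) = (\<lambda>\<rho>. proj (add_err (sem_float proj e1 \<rho>) (sem_float proj e2 \<rho>)))"
  "sem_float proj (Sub e1 e2) = (\<lambda>\<rho>. proj (sub_err (sem_float proj e1 \<rho>) (sem_float proj e2 \<rho>)))"
  "sem_float proj (Mul e1 e2) = (\<lambda>\<rho>. proj (mul_err (sem_float proj e1 \<rho>) (sem_float proj e2 \<rho>)))"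
  "sem_float proj (Div e1 e2) = (\<lambda>\<rho>. proj (div_err (sem_float proj e1 \<rho>) (sem_float proj e2 \<rho>)))"
  by (simp_all add: fun_eq_iff)

text \<open>An exact result may leave \<open>float_err F\<close>, but operation and rounding
  together form one function with values in this countable discrete set. The induction therefore
  applies the preceding lemma to the composite.\<close>

lemma measurable_sem_float:
  assumes A: "countable (float_err F)"
    and proj: "\<And>r. proj r \<in> float_err F"
    and "vars e \<subseteq> V"
  shows "sem_float proj e \<in> measurable (float_env_space F V) (float_err_space F)"
proof -
  \<comment> \<open>Measurability depends only on the sigma-algebras, which agree here.\<close>
  have eq: "measurable M (float_err_space F) = measurable M (count_space (float_err F))"
    for M :: "'c measure"
    by (intro measurable_cong_sets) (auto simp: sets_borel_of_discrete_topology)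
  note binop = measurable_countable_binop[OF A]
  from \<open>vars e \<subseteq> V\<close> show ?thesis
  proof (induction e)
    case (Const a)
    then show ?case
      by (simp add: sem_float_eqs eq proj)
  next
    case (Var x)
    then show ?case
      unfolding sem_float_eqs
      by (intro continuous_map_measurable_borel_of)
        (auto intro: continuous_map_product_projection)
  next
    case (Neg e)
    \<comment> \<open>Negation is treated as a binary operation that ignores its second
      argument.\<close>
    then show ?case
      by (simp add: sem_float_eqs eq binop[where h = "\<lambda>a _. proj (neg_err a)"] proj)
  next
    case (Add e1 e2)
    then show ?case
      by (simp add: sem_float_eqs eq binop[where h = "\<lambda>a b. proj (add_err a b)"] proj)
  next
    case (Sub e1 e2)
    then show ?case
      by (simp add: sem_float_eqs eq binop[where h = "\<lambda>a b. proj (sub_err a b)"] proj)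
  next
    case (Mul e1 e2)
    then show ?case
      by (simp add: sem_float_eqs eq binop[where h = "\<lambda>a b. proj (mul_err a b)"] proj)
  next
    case (Div e1 e2)
    then show ?case
      by (simp add: sem_float_eqs eq binop[where h = "\<lambda>a b. proj (div_err a b)"] proj)
  qed
qed

theorem proposition1:
  fixes V :: "'v set" and F :: "real set" and proj :: "real_err \<Rightarrow> real_err"
  assumes "countable V"
    and "finite F" and "F \<noteq> {}"
    and "is_proj F proj"
  shows "(\<forall>e. vars e \<subseteq> V \<longrightarrow> sem_real e \<in> measurable (real_env_space V) real_err_space) \<and>
    (finite V \<or> proj \<in> measurable real_err_space (float_err_space F) \<longrightarrow>
      (\<forall>e. vars e \<subseteq> V \<longrightarrow>
        sem_float proj e \<in> measurable (float_env_space F V) (float_err_space F)))"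
proof -
  have "countable (float_err F)"
    using \<open>finite F\<close> by (simp add: float_err_def countable_finite)
  moreover have "proj r \<in> float_err F" for r
    using \<open>is_proj F proj\<close> by (simp add: is_proj_def)
  ultimately show ?thesis
    by (intro conjI allI impI measurable_sem_real measurable_sem_float)
qed

end
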